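(* Let $G=(V,E)$ be a connected graph on $n$ vertices and let $i\in\{1,\ldots,n\}$. Then $z(G;i)=p(G;i)$ if and only if either $z(G;i)=p(G;i)=\binom{n}{i}$ or $z(G;i)=p(G;i)=0$.
   Context: Graphs are finite and simple. For $S\subseteq V$: $S$ is a power dominating set if, after coloring $S$, coloring every neighbor of a vertex of $S$ (domination step), and then repeatedly applying the forcing rule (a colored vertex with exactly one uncolored neighbor colors that neighbor) until no changes occur, all vertices are colored; $S$ is a zero forcing set if coloring $S$ and applying only the forcing rule repeatedly colors all vertices. $p(G;i)$ and $z(G;i)$ denote the numbers of power dominating sets and zero forcing sets of $G$ of size $i$. *)

theory Defs
  imports "Graph_Theory.Digraph_Component"
begin

text \<open>
  Finite simple graphs are the finite, loop-free, symmetric digraphs without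
  parallel arcs (locale \<open>graph\<close>): each undirected edge is a pair of opposite arcs.
\<close>

definition neighborhood :: "('a,'b) pre_digraph \<Rightarrow> 'a \<Rightarrow> 'a set" where
  "neighborhood G u = {v. u \<rightarrow>\<^bsub>G\<^esub> v}"

definition closed_neighborhood :: "('a,'b) pre_digraph \<Rightarrow> 'a set \<Rightarrow> 'a set" where
  "closed_neighborhood G S = S \<union> (\<Union>u\<in>S. neighborhood G u)"

text \<open>\<open>force G C C'\<close>: one application of the forcing rule turns the set \<open>C\<close> of
  colored vertices into \<open>C'\<close>.\<close>

inductive force :: "('a,'b) pre_digraph \<Rightarrow> 'a set \<Rightarrow> 'a set \<Rightarrow> bool" for G where
  "u \<in> C \<Longrightarrow> neighborhood G u - C = {v} \<Longrightarrow> force G C (insert v C)"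

definition zero_forcing_set :: "('a,'b) pre_digraph \<Rightarrow> 'a set \<Rightarrow> bool" where
  "zero_forcing_set G S \<longleftrightarrow> S \<subseteq> verts G \<and> (force G)\<^sup>*\<^sup>* S (verts G)"

definition power_dominating_set :: "('a,'b) pre_digraph \<Rightarrow> 'a set \<Rightarrow> bool" where
  "power_dominating_set G S \<longleftrightarrow>
     S \<subseteq> verts G \<and> (force G)\<^sup>*\<^sup>* (closed_neighborhood G S) (verts G)"

definition num_zero_forcing :: "('a,'b) pre_digraph \<Rightarrow> nat \<Rightarrow> nat" where
  "num_zero_forcing G i = card {S. zero_forcing_set G S \<and> card S = i}"

definition num_power_dominating :: "('a,'b) pre_digraph \<Rightarrow> nat \<Rightarrow> nat" where
  "num_power_dominating G i = card {S. power_dominating_set G S \<and> card S = i}"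

text \<open>The order in which forces are performed is irrelevant: the coloring in which no
  further force is possible is unique.\<close>

lemma force_le_stalled:
  assumes "(force G)\<^sup>*\<^sup>* S C" and "S \<subseteq> D" and "\<nexists>D'. force G D D'"
  shows "C \<subseteq> D"
  using assms
proof (induction rule: rtranclp_induct)
  case (step B C)
  from step.hyps(2) obtain u v
    where u: "u \<in> B" and v: "neighborhood G u - B = {v}" and C: "C = insert v B"
    by (cases rule: force.cases) auto
  have "B \<subseteq> D" using step by blast
  moreover have "v \<in> D"
  proof (rule ccontr)
    assume "v \<notin> D"
    then have "neighborhood G u - D = {v}" using v \<open>B \<subseteq> D\<close> by blast
    then have "force G D (insert v D)" using u \<open>B \<subseteq> D\<close> by (blast intro: force.intros)
    then show False using step.prems by blast
  qed
  ultimately show ?case using C by blast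
qed auto

lemma stalled_coloring_unique:
  assumes "(force G)\<^sup>*\<^sup>* S C" "\<nexists>C'. force G C C'"
    and "(force G)\<^sup>*\<^sup>* S D" "\<nexists>D'. force G D D'"
  shows "C = D"
proof -
  have mono: "A \<subseteq> B" if "(force G)\<^sup>*\<^sup>* A B" for A B
    using that by (induction rule: rtranclp_induct) (auto elim: force.cases)
  show ?thesis
    using force_le_stalled assms mono by (metis subset_antisym)
qed

end

theory Submission
  imports Defs
begin

text \<open>
  Slide a vertex \<open>a\<close> of a zero forcing set \<open>S\<close> along an edge to some \<open>b \<notin> S\<close>. The closed
  neighborhood of the resulting set contains \<open>S\<close>, so the result is power dominating. Zero forcing
  sets are power dominating, so if both kinds are equinumerous in size \<open>i\<close>, they coincide in that
  size, and hence zero forcing sets of size \<open>i\<close> are closed under slides. In a connected graph any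
  vertex set can be turned into any other of the same size by slides; so either no vertex set of
  size \<open>i\<close> is zero forcing, or all are.
\<close>

text \<open>Extra colored vertices never block a force: if its target \<open>v\<close> lies in
  \<open>D\<close>, the step becomes void; otherwise \<open>v\<close> is still the only uncolored
  neighbor of \<open>u\<close>.\<close>

lemma forces_union:
  assumes "(force G)\<^sup>*\<^sup>* S C"
  shows "(force G)\<^sup>*\<^sup>* (S \<union> D) (C \<union> D)"
  using assms
proof (induction rule: rtranclp_induct)
  case (step B C)
  from step.hyps(2) obtain u v
    where u: "u \<in> B" and v: "neighborhood G u - B = {v}" and C: "C = insert v B"
    by (cases rule: force.cases) auto
  show ?case
  proof (cases "v \<in> D")
    case True
    then have "C \<union> D = B \<union> D" using C by blast
    then show ?thesis using step.IH by simp
  next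
    case False
    then have "neighborhood G u - (B \<union> D) = {v}" using v by blast
    then have "force G (B \<union> D) (insert v (B \<union> D))" using u by (blast intro: force.intros)
    then show ?thesis using step.IH C by (simp add: rtranclp.rtrancl_into_rtrancl)
  qed
qed simp

lemma forces_verts_mono:
  assumes "(force G)\<^sup>*\<^sup>* S (verts G)" and "S \<subseteq> D" and "D \<subseteq> verts G"
  shows "(force G)\<^sup>*\<^sup>* D (verts G)"
  using forces_union[OF assms(1), of D] assms(2,3) by (simp add: Un_absorb1 Un_absorb2)

context wf_digraph
begin

lemma closed_neighborhood_subset_verts:
  assumes "S \<subseteq> verts G"
  shows "closed_neighborhood G S \<subseteq> verts G"
  using assms by (auto simp: closed_neighborhood_def neighborhood_def dest: adj_in_verts)

text \<open>The domination step from \<open>T\<close> already colors all of \<open>S\<close>, and a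
  larger coloring forces at least as much.\<close>

lemma power_dominating_if_zero_forcing_subset:
  assumes "zero_forcing_set G S" and "T \<subseteq> verts G" and "S \<subseteq> closed_neighborhood G T"
  shows "power_dominating_set G T"
  using assms forces_verts_mono closed_neighborhood_subset_verts
  unfolding power_dominating_set_def zero_forcing_set_def by blast

lemma zero_forcing_imp_power_dominating:
  assumes "zero_forcing_set G S"
  shows "power_dominating_set G S"
  by (rule power_dominating_if_zero_forcing_subset[OF assms])
    (use assms in \<open>auto simp: zero_forcing_set_def closed_neighborhood_def\<close>)

text \<open>Induction along a walk from \<open>a\<close> to \<open>b\<close>, whose next vertex is
  \<open>c\<close>. The set \<open>S\<close> stays arbitrary because the induction hypothesis is
  also needed for the set obtained after a slide.\<close>

lemma slides_exchange:
  assumes slide: "\<And>S a b. P S \<Longrightarrow> a \<in> S \<Longrightarrow> b \<notin> S \<Longrightarrow> a \<rightarrow>\<^bsub>G\<^esub> b \<Longrightarrow> P (insert b (S - {a}))"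
    and "a \<rightarrow>\<^sup>*\<^bsub>G\<^esub> b" and "P S" and "a \<in> S" and "b \<notin> S"
  shows "P (insert b (S - {a}))"
  using assms(2-)
proof (induction arbitrary: S rule: converse_reachable_induct)
  case base
  then show ?case by simp
next
  case (step a c)
  consider "c = a \<or> c = b" | "c \<noteq> a" "c \<noteq> b" "c \<in> S" | "c \<noteq> b" "c \<notin> S" by blast
  then show ?case
  proof cases
    case 1
    then show ?thesis using step slide by blast
  next
    case 2
    \<comment> \<open>The walk is blocked at \<open>c\<close>: first move \<open>c\<close> on to \<open>b\<close>, then refill \<open>c\<close> from \<open>a\<close>.\<close>
    have "P (insert b (S - {c}))" using step 2 by blast
    then have "P (insert c (insert b (S - {c}) - {a}))"
      by (rule slide) (use step 2 in auto)
    moreover have "insert c (insert b (S - {c}) - {a}) = insert b (S - {a})"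
      using step 2 by blast
    ultimately show ?thesis by simp
  next
    case 3
    \<comment> \<open>Here \<open>c\<close> is free, so \<open>a\<close> slides to \<open>c\<close>;
      the induction hypothesis for the new set then carries \<open>c\<close> on to
      \<open>b\<close>.\<close>
    have "P (insert c (S - {a}))" by (rule slide) (use step 3 in auto)
    then have "P (insert b (insert c (S - {a}) - {c}))"
      by (rule step.IH) (use step 3 in auto)
    moreover have "insert b (insert c (S - {a}) - {c}) = insert b (S - {a})"
      using 3 by blast
    ultimately show ?thesis by simp
  qed
qed

end

lemma card_exchange:
  assumes "finite S" and "a \<in> S" and "b \<notin> S"
  shows "card (insert b (S - {a})) = card S"
  using assms card.remove[OF assms(1,2)] by simp

text \<open>Exchanging a vertex of \<open>S - T\<close> for one of \<open>T - S\<close> preserves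
  \<open>P\<close> and the size, and shrinks \<open>S - T\<close> by one.\<close>

lemma (in fin_digraph) slides_transitive:
  assumes slide: "\<And>S a b. P S \<Longrightarrow> a \<in> S \<Longrightarrow> b \<notin> S \<Longrightarrow> a \<rightarrow>\<^bsub>G\<^esub> b \<Longrightarrow> P (insert b (S - {a}))"
    and sc: "strongly_connected G"
    and "P S" and "S \<subseteq> verts G" and "T \<subseteq> verts G" and "card S = card T"
  shows "P T"
  using assms(3-)
proof (induction "card (S - T)" arbitrary: S)
  case 0
  have fin: "finite S" "finite T" using 0 by (auto intro: finite_subset)
  then have "S \<subseteq> T" using 0 by simp
  then show ?case using 0 fin card_subset_eq by metis
next
  case (Suc k)
  have fin: "finite S" "finite T" using Suc by (auto intro: finite_subset)
  obtain a where a: "a \<in> S" "a \<notin> T" using Suc.hyps(2) fin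
    by (metis Diff_eq_empty_iff card.empty nat.distinct(1) subsetI)
  \<comment> \<open>As the sizes agree, inclusion would give \<open>T = S\<close>, contradicting the
    choice of \<open>a\<close>.\<close>
  have "\<not> T \<subseteq> S" using a fin Suc.prems(4) card_subset_eq by metis
  then obtain b where b: "b \<in> T" "b \<notin> S" by blast
  let ?S = "insert b (S - {a})"
  have "a \<rightarrow>\<^sup>*\<^bsub>G\<^esub> b" using a b Suc.prems sc by (auto simp: strongly_connected_def)
  then have "P ?S" using slides_exchange[of P, OF slide] Suc.prems a b by blast
  moreover have "?S - T = (S - T) - {a}" using a b by blast
  then have "k = card (?S - T)" using Suc.hyps(2) a fin by simp
  moreover have "card ?S = card T"
    using card_exchange[OF fin(1) a(1) b(2)] Suc.prems(4) by simp
  ultimately show ?case using Suc.hyps(1) Suc.prems b by blast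
qed

theorem theorem14:
  fixes G :: "('a,'b) pre_digraph" and n i :: nat
  assumes "Digraph.graph G" and "Digraph_Component.connected G"
    and "n = card (verts G)"
    and "i \<in> {1..n}"
  shows "num_zero_forcing G i = num_power_dominating G i \<longleftrightarrow>
           (num_zero_forcing G i = n choose i \<and> num_power_dominating G i = n choose i) \<or>
           (num_zero_forcing G i = 0 \<and> num_power_dominating G i = 0)"
proof
  interpret Digraph.graph G by fact
  let ?Z = "{S. zero_forcing_set G S \<and> card S = i}"
  let ?P = "{S. power_dominating_set G S \<and> card S = i}"
  let ?V = "{S. S \<subseteq> verts G \<and> card S = i}"
  have sc: "strongly_connected G"
    using symmetric_connected_imp_strongly_connected sym_arcs assms(2) by blast
  assume eq: "num_zero_forcing G i = num_power_dominating G i"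
  have "finite ?P" by (rule finite_subset[of _ "Pow (verts G)"]) (auto simp: power_dominating_set_def)
  moreover have "?Z \<subseteq> ?P" using zero_forcing_imp_power_dominating by blast
  ultimately have ZP: "?Z = ?P"
    using eq card_subset_eq unfolding num_zero_forcing_def num_power_dominating_def by blast
  have slide: "insert b (S - {a}) \<in> ?Z"
    if S: "S \<in> ?Z" and ab: "a \<in> S" "b \<notin> S" "a \<rightarrow>\<^bsub>G\<^esub> b" for S a b
  proof -
    have Sv: "S \<subseteq> verts G" using S by (simp add: zero_forcing_set_def)
    then have fin: "finite S" by (rule finite_subset) simp
    \<comment> \<open>Only \<open>a\<close> is lost from \<open>S\<close> by the slide; the reversed
      arc lets \<open>b\<close> dominate it.\<close>
    have "b \<rightarrow>\<^bsub>G\<^esub> a" using ab(3) sym_arcs by (auto simp: symmetric_def dest: symD)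
    then have "S \<subseteq> closed_neighborhood G (insert b (S - {a}))"
      by (auto simp: closed_neighborhood_def neighborhood_def)
    moreover have "insert b (S - {a}) \<subseteq> verts G" using Sv ab(3) adj_in_verts by blast
    ultimately have "power_dominating_set G (insert b (S - {a}))"
      using power_dominating_if_zero_forcing_subset S by blast
    moreover have "card (insert b (S - {a})) = i"
      using card_exchange[OF fin ab(1,2)] S by simp
    ultimately show ?thesis using ZP by blast
  qed
  show "(num_zero_forcing G i = n choose i \<and> num_power_dominating G i = n choose i) \<or>
        (num_zero_forcing G i = 0 \<and> num_power_dominating G i = 0)"
  proof (cases "?Z = {}")
    case True
    then have "num_zero_forcing G i = 0" unfolding num_zero_forcing_def by (simp only: card.empty)
    then show ?thesis using eq by simp
  next
    case False
    then obtain S where S: "S \<in> ?Z" by blast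
    \<comment> \<open>A single zero forcing set of size \<open>i\<close> reaches every
      \<open>i\<close>-subset by slides, so \<open>?Z\<close> is all of \<open>?V\<close>.\<close>
    have "T \<in> ?Z" if "T \<in> ?V" for T
      by (rule slides_transitive[where P = "\<lambda>S. S \<in> ?Z", OF slide sc S])
        (use that S in \<open>auto simp: zero_forcing_set_def\<close>)
    then have "?Z = ?V" by (auto simp: zero_forcing_set_def)
    then have "num_zero_forcing G i = n choose i"
      using n_subsets[of "verts G" i] assms(3) unfolding num_zero_forcing_def by simp
    then show ?thesis using eq by simp
  qed
qed auto

end
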